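(* Let $\Gamma\to\Sigma$ be an injective map of totally ordered abelian groups whose cokernel is finite. The following are equivalent: (a) $\Sigma^+$ is finite as a $\Gamma^+$-set, (b) $\Sigma^+$ is finitely generated over $\Gamma^+$, (c) either $\Gamma=\Sigma$, or $\Gamma$ is discrete and there exists an integer $n\geq1$ such that $\Sigma=\Gamma+\frac1n\mathbb{Z}\gamma$ where $\gamma$ is the smallest positive element of $\Gamma$.
   Context: Maps of totally ordered abelian groups are order-preserving homomorphisms. $\Gamma^+$ denotes the monoid of non-negative elements of a totally ordered abelian group $\Gamma$. For a monoid homomorphism $P\to Q$, $Q$ is finite as a $P$-set if there is a finite subset $S_0\subseteq Q$ with $Q=P+S_0$; $Q$ is finitely generated over $P$ if there is a finite subset $S\subseteq Q$ such that $P\oplus\mathbb{N}^S\to Q$ is surjective. A totally ordered abelian group $\Gamma$ is discrete if $\Gamma=0$ or if $\Gamma^+\setminus\{0\}$ has a smallest element. The expression $\frac1n\mathbb{Z}\gamma$ is understood inside $\Gamma\otimes\mathbb{Q}=\Sigma\otimes\mathbb{Q}$. *)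

theory Defs
  imports Complex_Main "HOL-Library.Poly_Mapping" "HOL-Library.FuncSet" "HOL-Library.Set_Algebras"
begin

text \<open>
  The tensor product over the integers is the free abelian group on the pairs, given by
  finitely supported integer-valued functions, modulo the subgroup generated by the
  bilinearity relations.
\<close>

inductive_set tensor_relations :: "('a::ab_group_add \<times> 'b::ab_group_add \<Rightarrow>\<^sub>0 int) set" where
  zero: "0 \<in> tensor_relations"
| left: "Poly_Mapping.single (x + x', y) 1 - Poly_Mapping.single (x, y) 1
           - Poly_Mapping.single (x', y) 1 \<in> tensor_relations"
| right: "Poly_Mapping.single (x, y + y') 1 - Poly_Mapping.single (x, y) 1
           - Poly_Mapping.single (x, y') 1 \<in> tensor_relations"
| diff: "u \<in> tensor_relations \<Longrightarrow> v \<in> tensor_relations \<Longrightarrow> u - v \<in> tensor_relations"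

lemma tensor_relations_uminus: "u \<in> tensor_relations \<Longrightarrow> - u \<in> tensor_relations"
  using tensor_relations.diff[OF tensor_relations.zero, of u] by simp

lemma tensor_relations_add:
  "u \<in> tensor_relations \<Longrightarrow> v \<in> tensor_relations \<Longrightarrow> u + v \<in> tensor_relations"
  using tensor_relations.diff[of u "- v"] tensor_relations_uminus[of v] by simp

definition tensor_eq ::
  "('a::ab_group_add \<times> 'b::ab_group_add \<Rightarrow>\<^sub>0 int) \<Rightarrow> ('a \<times> 'b \<Rightarrow>\<^sub>0 int) \<Rightarrow> bool" where
  "tensor_eq u v \<longleftrightarrow> u - v \<in> tensor_relations"

lemma equivp_tensor_eq: "equivp tensor_eq"
proof (rule equivpI)
  show "reflp tensor_eq"
    by (simp add: reflp_def tensor_eq_def tensor_relations.zero)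
  show "symp tensor_eq"
    unfolding symp_def tensor_eq_def using tensor_relations_uminus by fastforce
  show "transp tensor_eq"
    unfolding transp_def tensor_eq_def using tensor_relations_add by fastforce
qed

quotient_type (overloaded) ('a, 'b) tensor_product =
  "('a::ab_group_add \<times> 'b::ab_group_add) \<Rightarrow>\<^sub>0 int" / tensor_eq
  by (rule equivp_tensor_eq)

instantiation tensor_product :: (ab_group_add, ab_group_add) ab_group_add
begin

lift_definition zero_tensor_product :: "('a, 'b) tensor_product" is 0 .

lift_definition plus_tensor_product ::
  "('a, 'b) tensor_product \<Rightarrow> ('a, 'b) tensor_product \<Rightarrow> ('a, 'b) tensor_product" is "(+)"
  unfolding tensor_eq_def add_diff_add by (rule tensor_relations_add)

lift_definition uminus_tensor_product ::
  "('a, 'b) tensor_product \<Rightarrow> ('a, 'b) tensor_product" is uminus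
  unfolding tensor_eq_def minus_diff_minus by (rule tensor_relations_uminus)

lift_definition minus_tensor_product ::
  "('a, 'b) tensor_product \<Rightarrow> ('a, 'b) tensor_product \<Rightarrow> ('a, 'b) tensor_product" is "(-)"
proof -
  fix u u' v v' :: "'a \<times> 'b \<Rightarrow>\<^sub>0 int"
  assume "tensor_eq u u'" "tensor_eq v v'"
  moreover have "(u - v) - (u' - v') = (u - u') - (v - v')"
    by (simp add: algebra_simps)
  ultimately show "tensor_eq (u - v) (u' - v')"
    unfolding tensor_eq_def by (simp only: tensor_relations.diff)
qed

instance
  by standard
    (transfer, simp add: tensor_eq_def tensor_relations.zero algebra_simps)+

end

lift_definition tensor :: "'a::ab_group_add \<Rightarrow> 'b::ab_group_add \<Rightarrow> ('a, 'b) tensor_product"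
    (infixl \<open>\<otimes>\<close> 70)
  is "\<lambda>x y. Poly_Mapping.single (x, y) 1" .

lemma tensor_add_left: "(x + x') \<otimes> y = x \<otimes> y + x' \<otimes> y"
  by transfer (use tensor_relations.left in \<open>simp add: tensor_eq_def diff_diff_eq[symmetric]\<close>)

lemma tensor_add_right: "x \<otimes> (y + y') = x \<otimes> y + x \<otimes> y'"
  by transfer (use tensor_relations.right in \<open>simp add: tensor_eq_def diff_diff_eq[symmetric]\<close>)

definition rational_image :: "'a::ab_group_add set \<Rightarrow> ('a, rat) tensor_product set" where
  "rational_image A = (\<lambda>x. x \<otimes> 1) ` A"

text \<open>
  This is \<open>(1/n) \<int> x\<close>.  For an injective map \<open>f\<close> with finite cokernel, \<open>x \<otimes> q \<mapsto> f x \<otimes> q\<close>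
  identifies the rational tensor products of the two groups, so \<open>(1/n) \<int> x\<close> for \<open>x\<close> in the source
  becomes \<open>fractional_multiples n (f x)\<close>.
\<close>

definition fractional_multiples :: "nat \<Rightarrow> 'a::ab_group_add \<Rightarrow> ('a, rat) tensor_product set" where
  "fractional_multiples n x = range (\<lambda>k::int. x \<otimes> (of_int k / of_nat n))"

definition ordered_group_map ::
  "('a::linordered_ab_group_add \<Rightarrow> 'b::linordered_ab_group_add) \<Rightarrow> bool" where
  "ordered_group_map f \<longleftrightarrow> Modules.additive f \<and> mono f"

definition nonneg :: "'a::linordered_ab_group_add set" where
  "nonneg = {x. 0 \<le> x}"

definition cokernel :: "('a::ab_group_add \<Rightarrow> 'b::ab_group_add) \<Rightarrow> 'b set set" where
  "cokernel f = UNIV // {(x, y). x - y \<in> range f}"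

definition smallest_positive :: "'a::linordered_ab_group_add \<Rightarrow> bool" where
  "smallest_positive x \<longleftrightarrow> x \<in> nonneg - {0} \<and> (\<forall>y \<in> nonneg - {0}. x \<le> y)"

definition discrete_group :: "'a::linordered_ab_group_add itself \<Rightarrow> bool" where
  "discrete_group T \<longleftrightarrow> (UNIV :: 'a set) = {0} \<or> (\<exists>x::'a. smallest_positive x)"

text \<open>
  The monoids are submonoids \<open>P\<close> and \<open>Q\<close> of the ambient types, and the homomorphism is the
  restriction of \<open>f\<close> to \<open>P\<close>.  In the first definition the sum of sets is the elementwise one.
\<close>

definition finite_as_set_over ::
  "('p::comm_monoid_add \<Rightarrow> 'q::comm_monoid_add) \<Rightarrow> 'p set \<Rightarrow> 'q set \<Rightarrow> bool" where
  "finite_as_set_over f P Q \<longleftrightarrow> (\<exists>S. finite S \<and> S \<subseteq> Q \<and> Q = f ` P + S)"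

text \<open>
  The set \<open>S \<rightarrow>\<^sub>E UNIV\<close> of natural-valued functions encodes the free commutative monoid on \<open>S\<close>,
  and the inner sum is the multiple of \<open>s\<close> by the natural number \<open>a s\<close>.
\<close>

definition finitely_generated_over ::
  "('p::comm_monoid_add \<Rightarrow> 'q::comm_monoid_add) \<Rightarrow> 'p set \<Rightarrow> 'q set \<Rightarrow> bool" where
  "finitely_generated_over f P Q \<longleftrightarrow>
     (\<exists>S. finite S \<and> S \<subseteq> Q \<and>
        (\<lambda>(p, a). f p + (\<Sum>s\<in>S. \<Sum>i<a s. s)) ` (P \<times> (S \<rightarrow>\<^sub>E (UNIV :: nat set))) = Q)"

end

theory Submission
  imports Defs
begin

text \<open>
  Write \<open>\<Gamma>\<close> and \<open>\<Sigma>\<close> for the source and the target, and regard \<open>\<Gamma>\<close> as a subgroup of \<open>\<Sigma>\<close> through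
  \<open>f\<close>. Since the cokernel is finite, every element of \<open>\<Sigma>\<close> has a positive multiple in \<open>\<Gamma>\<close>. Hence
  in a combination of finitely many generators over the nonnegative part of \<open>\<Gamma>\<close> the coefficient
  of each generator can be reduced modulo a fixed integer, at the price of enlarging the
  contribution from \<open>\<Gamma>\<close>; only finitely many reduced combinations remain. This makes finite
  generation and finiteness as a set equivalent (\<open>finitely_generated_imp_finite\<close>).

  Finiteness as a set forces every coset of \<open>\<Gamma>\<close> to have a least nonnegative element, because the
  nonnegative part of a coset lies above finitely many of its own elements
  (\<open>least_nonneg_in_coset\<close>). If \<open>x\<close> is not in \<open>\<Gamma>\<close>, let \<open>s\<close> and \<open>t\<close> be the least nonnegative elements
  of \<open>x + \<Gamma>\<close> and \<open>- x + \<Gamma>\<close>. Every positive \<open>g\<close> in \<open>\<Gamma>\<close> exceeds \<open>s\<close>, since otherwise \<open>s - g\<close> would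
  be a smaller nonnegative element of the coset of \<open>x\<close>; then \<open>g - s\<close> is a nonnegative element of
  the opposite coset, so \<open>g \<ge> s + t\<close>. Thus \<open>\<gamma> = s + t\<close> is the smallest positive element of \<open>\<Gamma>\<close>
  (\<open>finite_imp_smallest_positive\<close>). The group \<open>\<Sigma>\<close> then has a smallest positive element \<open>\<delta>\<close> too, and
  every element between \<open>0\<close> and \<open>\<gamma>\<close> is a multiple of \<open>\<delta>\<close>. As these elements represent all
  cosets, \<open>\<Sigma> = \<Gamma> + \<int>\<delta>\<close> with \<open>\<gamma> = n \<delta>\<close>. Conversely, for such a \<open>\<delta>\<close> every nonnegative element
  is \<open>a + r \<delta>\<close> with \<open>0 \<le> r < n\<close>, and \<open>a\<close> cannot be negative because then \<open>a \<le> - \<gamma> = - n \<delta>\<close>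
  (\<open>adjoined_fraction_imp_finite\<close>).

  It remains to translate the equation in the rational tensor product into the existence of
  \<open>\<delta>\<close>. An ordered group is torsion free, so it embeds into its rational tensor product
  (\<open>tensor_one_cancel\<close>), and \<open>\<gamma> \<otimes> 1/n\<close> comes from an element \<open>\<delta>\<close> of \<open>\<Sigma>\<close> exactly when \<open>n \<delta> = \<gamma>\<close>
  (\<open>rational_image_eq_fractional_multiples_iff\<close>).
\<close>

section \<open>Integer multiples in abelian groups\<close>

text \<open>
  The module structure over the integers, written with the repeated sums that define finite
  generation; for each \<open>k\<close> at least one of the two sums is empty.
\<close>

definition int_multiple :: "int \<Rightarrow> 'a::ab_group_add \<Rightarrow> 'a" (infixr \<open>\<cdot>\<close> 75) where
  "k \<cdot> x = (\<Sum>i<nat k. x) - (\<Sum>i<nat (- k). x)"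

lemma int_multiple_of_nat: "int n \<cdot> x = (\<Sum>i<n. x)"
  by (simp add: int_multiple_def)

lemma repeated_sum_add:
  fixes m n :: nat and x :: "'a::ab_group_add"
  shows "(\<Sum>i<m + n. x) = (\<Sum>i<m. x) + (\<Sum>i<n. x)"
  by (induction n) (auto simp: algebra_simps)

text \<open>
  Writing integers as differences of naturals avoids case distinctions on signs: both sides
  depend on \<open>m\<close> and \<open>n\<close> only up to a common summand.
\<close>

lemma int_multiple_diff_of_nat:
  fixes m n :: nat and x :: "'a::ab_group_add"
  shows "(int m - int n) \<cdot> x = (\<Sum>i<m. x) - (\<Sum>i<n. x)"
proof (cases "n \<le> m")
  case True
  then have "(\<Sum>i<m. x) = (\<Sum>i<m - n. x) + (\<Sum>i<n. x)"
    using repeated_sum_add[of x "m - n" n] by simp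
  moreover have "nat (int m - int n) = m - n" "nat (- (int m - int n)) = 0"
    using True by auto
  ultimately show ?thesis by (simp add: int_multiple_def)
next
  case False
  then have "(\<Sum>i<n. x) = (\<Sum>i<n - m. x) + (\<Sum>i<m. x)"
    using repeated_sum_add[of x "n - m" m] by simp
  moreover have "nat (int m - int n) = 0" "nat (- (int m - int n)) = n - m"
    using False by auto
  ultimately show ?thesis by (simp add: int_multiple_def)
qed

lemma int_multiple_add_left: "(k + l) \<cdot> x = k \<cdot> x + l \<cdot> x"
proof -
  obtain a b where k: "k = int a - int b" by (rule int_diff_cases)
  obtain c d where l: "l = int c - int d" by (rule int_diff_cases)
  have "k + l = int (a + c) - int (b + d)" by (simp add: k l)
  then have "(k + l) \<cdot> x = (\<Sum>i<a + c. x) - (\<Sum>i<b + d. x)"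
    by (simp only: int_multiple_diff_of_nat)
  then show ?thesis
    by (simp add: k l int_multiple_diff_of_nat repeated_sum_add algebra_simps)
qed

lemma int_multiple_diff_left: "(k - l) \<cdot> x = k \<cdot> x - l \<cdot> x"
  using int_multiple_add_left[of "k - l" l x] by (simp add: algebra_simps)

lemma int_multiple_one: "1 \<cdot> x = x"
  using int_multiple_of_nat[of 1 x] by simp

lemma additive_int_multiple:
  assumes "Modules.additive h"
  shows "h (k \<cdot> x) = k \<cdot> h x"
  unfolding int_multiple_def using assms by (simp add: additive.diff additive.sum)

interpretation int_module: module int_multiple
proof
  fix k l :: int and x y :: 'a
  show "k \<cdot> (x + y) = k \<cdot> x + k \<cdot> y"
    by (simp add: int_multiple_def sum.distrib)
  show "(k + l) \<cdot> x = k \<cdot> x + l \<cdot> x"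
    by (rule int_multiple_add_left)
  have "Modules.additive (\<lambda>k. k \<cdot> x)"
    by (simp add: additive_def int_multiple_add_left)
  \<comment> \<open>Associativity is the instance of \<open>additive_int_multiple\<close> for the additive map \<open>l \<mapsto> l \<cdot> x\<close>.\<close>
  then have "(k \<cdot> l) \<cdot> x = k \<cdot> l \<cdot> x"
    by (rule additive_int_multiple)
  moreover have "k \<cdot> l = k * l"
    by (cases "k \<ge> 0") (auto simp: int_multiple_def)
  ultimately show "k \<cdot> l \<cdot> x = (k * l) \<cdot> x" by simp
  show "1 \<cdot> x = x"
    by (rule int_multiple_one)
qed

lemma int_multiple_rat: "k \<cdot> q = of_int k * q" for q :: rat
  by (cases "k \<ge> 0") (auto simp: int_multiple_def)

lemma int_multiple_nonneg:
  fixes x :: "'a::linordered_ab_group_add"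
  assumes "0 \<le> k" "0 \<le> x"
  shows "0 \<le> k \<cdot> x"
  using assms by (simp add: int_multiple_def sum_nonneg)

lemma int_multiple_pos:
  fixes x :: "'a::linordered_ab_group_add"
  assumes "0 < k" "0 < x"
  shows "0 < k \<cdot> x"
proof -
  have "k \<cdot> x = (k - 1) \<cdot> x + x"
    by (simp add: int_module.scale_left_diff_distrib)
  moreover have "0 \<le> (k - 1) \<cdot> x"
    using assms by (intro int_multiple_nonneg) auto
  ultimately show ?thesis using assms(2) by (simp add: add_nonneg_pos)
qed

lemma ordered_group_torsion_free:
  fixes x :: "'a::linordered_ab_group_add"
  assumes "0 < k" "k \<cdot> x = 0"
  shows "x = 0"
proof (rule ccontr)
  assume "x \<noteq> 0"
  then consider "0 < x" | "0 < - x" by fastforce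
  then show False
    using int_multiple_pos[OF assms(1), of x] int_multiple_pos[OF assms(1), of "- x"] assms(2)
    by cases auto
qed

section \<open>Elements of the rational tensor product\<close>

lemma additive_tensor_left: "Modules.additive (\<lambda>x. x \<otimes> y)"
  by (simp add: additive_def tensor_add_left)

lemma additive_tensor_right: "Modules.additive (\<lambda>y. x \<otimes> y)"
  by (simp add: additive_def tensor_add_right)

lemma tensor_int_multiple: "(k \<cdot> x) \<otimes> q = x \<otimes> (of_int k * q)" for q :: rat
  using additive_int_multiple[OF additive_tensor_left, of k x q]
    additive_int_multiple[OF additive_tensor_right, of x k q]
  by (simp add: int_multiple_rat)

text \<open>
  For a common denominator \<open>M\<close> of the rationals that occur in a representative \<open>u\<close>, this is the
  element \<open>z\<close> with \<open>z \<otimes> 1 = M u\<close> in the tensor product. The floor only serves to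
  have an integer coefficient for every \<open>M\<close>; for a common denominator it is exact.
\<close>

definition cleared_value :: "int \<Rightarrow> ('a::ab_group_add \<times> rat \<Rightarrow>\<^sub>0 int) \<Rightarrow> 'a" where
  "cleared_value M u =
     (\<Sum>p\<in>Poly_Mapping.keys u. (Poly_Mapping.lookup u p * \<lfloor>of_int M * snd p\<rfloor>) \<cdot> fst p)"

lemma cleared_value_superset:
  assumes "finite A" "Poly_Mapping.keys u \<subseteq> A"
  shows "cleared_value M u =
    (\<Sum>p\<in>A. (Poly_Mapping.lookup u p * \<lfloor>of_int M * snd p\<rfloor>) \<cdot> fst p)"
  unfolding cleared_value_def using assms
  by (intro sum.mono_neutral_left) (auto simp: in_keys_iff)

lemma cleared_value_diff: "cleared_value M (u - v) = cleared_value M u - cleared_value M v"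
proof -
  define A where "A = Poly_Mapping.keys u \<union> Poly_Mapping.keys v"
  have "finite A" "Poly_Mapping.keys u \<subseteq> A" "Poly_Mapping.keys v \<subseteq> A"
    "Poly_Mapping.keys (u - v) \<subseteq> A"
    using keys_diff[of u v] by (auto simp: A_def)
  then show ?thesis
    by (simp add: cleared_value_superset[of A] lookup_minus int_module.scale_left_diff_distrib
        left_diff_distrib sum_subtractf)
qed

lemma cleared_value_single: "cleared_value M (Poly_Mapping.single (x, q) 1) = \<lfloor>of_int M * q\<rfloor> \<cdot> x"
  by (simp add: cleared_value_def)

text \<open>
  A relation uses only finitely many rationals. Once \<open>M\<close> clears their denominators, the floors are
  exact and the value respects the relation. Asking for all multiples of \<open>N\<close> lets two relations
  share a common \<open>M\<close>.
\<close>

lemma cleared_value_tensor_relations: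
  assumes "u \<in> tensor_relations"
  shows "\<exists>N>0. \<forall>M. N dvd M \<longrightarrow> cleared_value M u = 0"
  using assms
proof induction
  case zero
  show ?case by (auto simp: cleared_value_def intro: exI[of _ 1])
next
  case (left x x' y)
  show ?case
    by (auto simp: cleared_value_diff cleared_value_single int_module.scale_right_distrib
        intro: exI[of _ 1])
next
  case (right x y y')
  obtain a b where ab: "quotient_of y = (a, b)" by force
  then have b: "0 < b" "y = of_int a / of_int b"
    using quotient_of_denom_pos quotient_of_div by auto
  \<comment> \<open>It is enough that one of the two summands becomes an integer.\<close>
  have "cleared_value M (Poly_Mapping.single (x, y + y') 1 - Poly_Mapping.single (x, y) 1
      - Poly_Mapping.single (x, y') 1) = 0" if "b dvd M" for M
  proof -
    from that obtain c where "M = b * c" by (rule dvdE)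
    then have int: "of_int M * y = of_int (c * a)" using b by simp
    have "of_int M * (y + y') = of_int M * y' + of_int (c * a)"
      unfolding int[symmetric] by (simp add: algebra_simps)
    then have "\<lfloor>of_int M * (y + y')\<rfloor> = \<lfloor>of_int M * y'\<rfloor> + c * a"
      by (simp only: floor_add_int)
    moreover have "\<lfloor>of_int M * y\<rfloor> = c * a" unfolding int by (rule floor_of_int)
    ultimately show ?thesis
      by (simp add: cleared_value_diff cleared_value_single int_multiple_add_left)
  qed
  then show ?case using b(1) by blast
next
  case (diff u v)
  then obtain N N' where N: "0 < N" "\<And>M. N dvd M \<Longrightarrow> cleared_value M u = 0"
    and N': "0 < N'" "\<And>M. N' dvd M \<Longrightarrow> cleared_value M v = 0" by blast
  have "cleared_value M (u - v) = 0" if "N * N' dvd M" for M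
    using N(2)[of M] N'(2)[of M] that by (auto simp: cleared_value_diff dest: dvd_mult_left dvd_mult_right)
  moreover have "0 < N * N'" using N(1) N'(1) by simp
  ultimately show ?case by blast
qed

text \<open>
  Clearing denominators in a relation that identifies \<open>x \<otimes> 1\<close> with \<open>y \<otimes> 1\<close> exhibits \<open>x - y\<close> as a
  torsion element.
\<close>

lemma tensor_one_cancel:
  fixes x y :: "'a::linordered_ab_group_add"
  assumes "x \<otimes> (1::rat) = y \<otimes> 1"
  shows "x = y"
proof -
  have "tensor_eq (Poly_Mapping.single (x, 1::rat) 1) (Poly_Mapping.single (y, 1) 1)"
    using assms by transfer
  then have "Poly_Mapping.single (x, 1::rat) 1 - Poly_Mapping.single (y, 1) 1 \<in> tensor_relations"
    unfolding tensor_eq_def .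
  from cleared_value_tensor_relations[OF this] obtain N where "0 < N"
    and "cleared_value N (Poly_Mapping.single (x, 1::rat) 1 - Poly_Mapping.single (y, 1) 1) = 0"
    by (meson dvd_refl)
  then have "0 < N" "N \<cdot> (x - y) = 0"
    by (auto simp: cleared_value_diff cleared_value_single int_module.scale_right_diff_distrib)
  then show ?thesis using ordered_group_torsion_free by fastforce
qed

text \<open>
  The inclusion from right to left puts \<open>c \<otimes> 1/n\<close> into the image of the group, say as \<open>\<delta> \<otimes> 1\<close>, and
  torsion-freeness gives \<open>n \<delta> = c\<close>. Then \<open>c \<otimes> k/n = k \<delta> \<otimes> 1\<close>, so the equation takes place in the
  image of the group and can be pulled back.
\<close>

lemma rational_image_eq_fractional_multiples_iff:
  fixes c :: "'a::linordered_ab_group_add"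
  assumes "0 < n" "0 \<in> A"
  shows "rational_image UNIV = rational_image A + fractional_multiples n c \<longleftrightarrow>
    (\<exists>\<delta>. int n \<cdot> \<delta> = c \<and> (\<forall>x. \<exists>a\<in>A. \<exists>k. x = a + k \<cdot> \<delta>))"
proof
  assume eq: "rational_image UNIV = rational_image A + fractional_multiples n c"
  have "0 \<otimes> 1 + c \<otimes> (of_int 1 / of_nat n) \<in> rational_image A + fractional_multiples n c"
    unfolding rational_image_def fractional_multiples_def
    using assms(2) by (intro set_plus_intro imageI rangeI)
  then obtain \<delta> where \<delta>: "\<delta> \<otimes> 1 = c \<otimes> (1 / of_nat n :: rat)"
    unfolding eq[symmetric] by (auto simp: rational_image_def additive.zero[OF additive_tensor_left])
  have "(int n \<cdot> \<delta>) \<otimes> (1::rat) = int n \<cdot> (\<delta> \<otimes> 1)"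
    by (rule additive_int_multiple[OF additive_tensor_left])
  also have "\<dots> = c \<otimes> (int n \<cdot> (1 / of_nat n))"
    unfolding \<delta> by (rule additive_int_multiple[OF additive_tensor_right, symmetric])
  also have "\<dots> = c \<otimes> 1" using assms(1) by (simp add: int_multiple_rat)
  finally have n\<delta>: "int n \<cdot> \<delta> = c" by (rule tensor_one_cancel)
  have "\<exists>a\<in>A. \<exists>k. x = a + k \<cdot> \<delta>" for x
  proof -
    have "x \<otimes> 1 \<in> rational_image A + fractional_multiples n c"
      unfolding eq[symmetric] by (simp add: rational_image_def)
    then obtain a k where "a \<in> A" and x: "x \<otimes> 1 = a \<otimes> 1 + c \<otimes> (of_int k / of_nat n :: rat)"
      by (auto simp: rational_image_def fractional_multiples_def elim!: set_plus_elim)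
    have "c \<otimes> (of_int k / of_nat n :: rat) = (k \<cdot> \<delta>) \<otimes> 1"
      unfolding n\<delta>[symmetric] tensor_int_multiple using assms(1) by simp
    with x have "x \<otimes> (1::rat) = (a + k \<cdot> \<delta>) \<otimes> 1" by (simp add: tensor_add_left)
    then have "x = a + k \<cdot> \<delta>" by (rule tensor_one_cancel)
    with \<open>a \<in> A\<close> show ?thesis by blast
  qed
  with n\<delta> show "\<exists>\<delta>. int n \<cdot> \<delta> = c \<and> (\<forall>x. \<exists>a\<in>A. \<exists>k. x = a + k \<cdot> \<delta>)" by blast
next
  assume "\<exists>\<delta>. int n \<cdot> \<delta> = c \<and> (\<forall>x. \<exists>a\<in>A. \<exists>k. x = a + k \<cdot> \<delta>)"
  then obtain \<delta> where \<delta>: "int n \<cdot> \<delta> = c" "\<And>x. \<exists>a\<in>A. \<exists>k. x = a + k \<cdot> \<delta>" by blast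
  have frac: "c \<otimes> (of_int k / of_nat n :: rat) = (k \<cdot> \<delta>) \<otimes> 1" for k
    unfolding \<delta>(1)[symmetric] tensor_int_multiple using assms(1) by simp
  show "rational_image UNIV = rational_image A + fractional_multiples n c"
  proof
    show "rational_image UNIV \<subseteq> rational_image A + fractional_multiples n c"
    proof
      fix z :: "('a, rat) tensor_product" assume "z \<in> rational_image UNIV"
      then obtain x where "z = x \<otimes> 1" by (auto simp: rational_image_def)
      moreover obtain a k where "a \<in> A" "x = a + k \<cdot> \<delta>" using \<delta>(2) by blast
      ultimately have "z = a \<otimes> 1 + c \<otimes> (of_int k / of_nat n)"
        by (simp add: tensor_add_left frac)
      with \<open>a \<in> A\<close> show "z \<in> rational_image A + fractional_multiples n c"
        unfolding rational_image_def fractional_multiples_def by (auto intro!: set_plus_intro)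
    qed
    show "rational_image A + fractional_multiples n c \<subseteq> rational_image UNIV"
      by (auto simp: rational_image_def fractional_multiples_def frac tensor_add_left[symmetric]
          elim!: set_plus_elim)
  qed
qed

section \<open>Extensions of ordered groups of finite index\<close>

locale finite_index_extension =
  fixes f :: "'g::linordered_ab_group_add \<Rightarrow> 's::linordered_ab_group_add"
  assumes ordered_map: "ordered_group_map f"
    and injective: "inj f"
    and finite_cokernel: "finite (cokernel f)"
begin

lemma additive_map: "Modules.additive f"
  using ordered_map by (simp add: ordered_group_map_def)

lemmas map_add = additive.add[OF additive_map]
  and map_diff = additive.diff[OF additive_map]
  and map_minus = additive.minus[OF additive_map]
  and map_zero = additive.zero[OF additive_map]
  and map_int_multiple = additive_int_multiple[OF additive_map]

lemma map_le_iff: "f a \<le> f b \<longleftrightarrow> a \<le> b"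
proof -
  have "strict_mono f"
    using ordered_map injective unfolding ordered_group_map_def
    by (auto intro!: strict_monoI simp: order.strict_iff_order dest: monoD injD)
  then show ?thesis by (rule strict_mono_less_eq)
qed

lemma map_nonneg_iff: "0 \<le> f a \<longleftrightarrow> 0 \<le> a"
  using map_le_iff[of 0 a] by (simp add: map_zero)

lemma map_less_iff: "f a < f b \<longleftrightarrow> a < b"
  by (simp add: less_le_not_le map_le_iff)

lemma map_pos_iff: "0 < f a \<longleftrightarrow> 0 < a"
  using map_less_iff[of 0 a] by (simp add: map_zero)

text \<open>
  Two of the infinitely many multiples of \<open>x\<close> lie in the same one of the finitely many cosets.
\<close>

lemma multiple_in_range: "\<exists>m::nat. 0 < m \<and> (\<exists>g. int m \<cdot> x = f g)"
proof -
  let ?R = "{(x, y). x - y \<in> range f}"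
  define C where "C i = ?R `` {int i \<cdot> x}" for i :: nat
  have "range C \<subseteq> cokernel f"
    unfolding C_def cokernel_def by (blast intro: quotientI)
  then have "\<not> inj C"
    using finite_cokernel finite_subset finite_imageD infinite_UNIV_nat by blast
  then obtain i j where "i \<noteq> j" "C i = C j" by (auto simp: inj_def)
  then have "\<exists>i j. i < j \<and> C i = C j" by (metis linorder_neqE_nat)
  then obtain i j where ij: "i < j" "C i = C j" by blast
  have "int i \<cdot> x \<in> C i" using map_zero by (auto simp: C_def intro: rangeI[of f 0, unfolded map_zero])
  then have "int j \<cdot> x - int i \<cdot> x \<in> range f" using ij(2) by (auto simp: C_def)
  then obtain g where "int j \<cdot> x - int i \<cdot> x = f g" by blast
  then have "int (j - i) \<cdot> x = f g"
    using ij(1) by (simp add: of_nat_diff int_multiple_diff_left)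
  then show ?thesis using ij(1) by (intro exI[of _ "j - i"]) auto
qed

lemma finite_imp_finitely_generated:
  assumes "finite_as_set_over f nonneg nonneg"
  shows "finitely_generated_over f nonneg nonneg"
proof -
  obtain S where S: "finite S" "S \<subseteq> nonneg" "nonneg = f ` nonneg + S"
    using assms unfolding finite_as_set_over_def by blast
  let ?F = "\<lambda>(p, a). f p + (\<Sum>s\<in>S. \<Sum>i<a s. s)"
  have "y \<in> ?F ` (nonneg \<times> (S \<rightarrow>\<^sub>E (UNIV :: nat set)))" if "y \<in> nonneg" for y
  proof -
    have "y \<in> f ` nonneg + S" using that S(3) by blast
    then obtain p t where pt: "p \<in> nonneg" "t \<in> S" "y = f p + t" by (auto elim: set_plus_elim)
    \<comment> \<open>The exponent vector that takes the generator \<open>t\<close> once.\<close>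
    let ?a = "restrict (\<lambda>s. if s = t then 1 else 0 :: nat) S"
    have "(\<Sum>s\<in>S. \<Sum>i<?a s. s) = (\<Sum>s\<in>S. if s = t then s else 0)"
      by (intro sum.cong) auto
    also have "\<dots> = t" using pt S(1) by simp
    finally have "y = ?F (p, ?a)" using pt by simp
    moreover have "(p, ?a) \<in> nonneg \<times> (S \<rightarrow>\<^sub>E UNIV)" using pt by auto
    ultimately show ?thesis by (rule image_eqI)
  qed
  moreover have "?F (p, a) \<in> nonneg" if "p \<in> nonneg" for p a
    using that S(2) map_nonneg_iff by (auto simp: nonneg_def intro!: add_nonneg_nonneg sum_nonneg)
  ultimately have "?F ` (nonneg \<times> (S \<rightarrow>\<^sub>E (UNIV :: nat set))) = nonneg" by fastforce
  then show ?thesis unfolding finitely_generated_over_def using S(1,2) by blast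
qed

text \<open>
  A multiple \<open>m s\<close> of each generator \<open>s\<close> lies in the image of the nonnegative part of the source,
  so division with remainder by \<open>m\<close> moves all but a bounded number of copies of \<open>s\<close> there.
\<close>

lemma finitely_generated_imp_finite:
  assumes "finitely_generated_over f nonneg nonneg"
  shows "finite_as_set_over f nonneg nonneg"
proof -
  obtain S where S: "finite S" "S \<subseteq> nonneg"
    and gen: "(\<lambda>(p, a). f p + (\<Sum>s\<in>S. \<Sum>i<a s. s)) ` (nonneg \<times> (S \<rightarrow>\<^sub>E (UNIV :: nat set))) = nonneg"
    using assms unfolding finitely_generated_over_def by blast
  obtain m g where m: "\<And>x. 0 < m x" "\<And>x. int (m x) \<cdot> x = f (g x)"
    using multiple_in_range by metis
  have g: "0 \<le> g s" if "s \<in> S" for s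
    using int_multiple_nonneg[of "int (m s)" s] that S(2) by (auto simp: m(2) map_nonneg_iff nonneg_def)
  define T where "T = (\<lambda>a. \<Sum>s\<in>S. \<Sum>i<a s. s) ` (\<Pi>\<^sub>E s\<in>S. {..<m s})"
  have "finite T" unfolding T_def using S(1) by (intro finite_imageI finite_PiE) auto
  moreover have T: "T \<subseteq> nonneg"
    using S(2) by (auto simp: T_def nonneg_def intro!: sum_nonneg)
  moreover have "nonneg = f ` nonneg + T"
  proof
    show "f ` nonneg + T \<subseteq> nonneg"
      using T by (auto simp: nonneg_def map_nonneg_iff elim!: set_plus_elim intro!: add_nonneg_nonneg)
    show "nonneg \<subseteq> f ` nonneg + T"
    proof
      fix y :: 's assume "y \<in> nonneg"
      then have "y \<in> (\<lambda>(p, a). f p + (\<Sum>s\<in>S. \<Sum>i<a s. s)) ` (nonneg \<times> (S \<rightarrow>\<^sub>E (UNIV :: nat set)))"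
        unfolding gen .
      then obtain w where w: "w \<in> nonneg \<times> (S \<rightarrow>\<^sub>E (UNIV :: nat set))"
        "y = (\<lambda>(p, a). f p + (\<Sum>s\<in>S. \<Sum>i<a s. s)) w" by (rule imageE)
      obtain p a where "w = (p, a)" by (cases w)
      with w have p: "p \<in> nonneg" and y: "y = f p + (\<Sum>s\<in>S. \<Sum>i<a s. s)" by auto
      define r where "r = restrict (\<lambda>s. a s mod m s) S"
      define q where "q = p + (\<Sum>s\<in>S. int (a s div m s) \<cdot> g s)"
      have "(\<Sum>i<a s. s) = f (int (a s div m s) \<cdot> g s) + (\<Sum>i<r s. s)" if "s \<in> S" for s
      proof -
        have "int (a s) = int (a s div m s) * int (m s) + int (r s)"
          using that by (simp add: r_def flip: of_nat_mult of_nat_add)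
        then have "int (a s) \<cdot> s = int (a s div m s) \<cdot> int (m s) \<cdot> s + int (r s) \<cdot> s"
          by (simp add: int_multiple_add_left)
        then show ?thesis by (simp only: m(2) map_int_multiple flip: int_multiple_of_nat)
      qed
      then have "y = f q + (\<Sum>s\<in>S. \<Sum>i<r s. s)"
        by (simp add: y q_def map_add additive.sum[OF additive_map] sum.distrib add.assoc)
      moreover have "q \<in> nonneg"
        using p g by (auto simp: q_def nonneg_def intro!: add_nonneg_nonneg sum_nonneg int_multiple_nonneg)
      moreover have "(\<Sum>s\<in>S. \<Sum>i<r s. s) \<in> T"
        unfolding T_def using m(1) by (intro imageI) (auto simp: r_def)
      ultimately show "y \<in> f ` nonneg + T" by (auto intro: set_plus_intro)
    qed
  qed
  ultimately show ?thesis unfolding finite_as_set_over_def by blast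
qed

lemma surj_imp_finite:
  assumes "range f = UNIV"
  shows "finite_as_set_over f nonneg nonneg"
proof -
  have "y \<in> f ` nonneg" if "y \<in> nonneg" for y
  proof -
    obtain x where "y = f x" using assms by (metis surjD)
    then show ?thesis using that by (auto simp: nonneg_def map_nonneg_iff)
  qed
  then have "f ` nonneg = nonneg"
    by (auto simp: nonneg_def map_nonneg_iff)
  then have "nonneg = f ` nonneg + {0}" by (auto simp: set_plus_def)
  then show ?thesis
    unfolding finite_as_set_over_def by (intro exI[of _ "{0}"]) (auto simp: nonneg_def)
qed

text \<open>
  The remainders \<open>r \<delta>\<close> with \<open>0 \<le> r < n\<close> suffice: in \<open>f b + k \<cdot> \<delta>\<close> the full multiples of \<open>n \<delta> = f \<gamma>\<close> are
  absorbed into \<open>b\<close>, and the resulting element of the source is nonnegative because a negative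
  one is at most \<open>- \<gamma>\<close>, which \<open>r \<delta>\<close> cannot compensate.
\<close>

lemma adjoined_fraction_imp_finite:
  assumes "smallest_positive \<gamma>" "0 < n" "int n \<cdot> \<delta> = f \<gamma>"
    and gen: "\<And>x. \<exists>a\<in>range f. \<exists>k. x = a + k \<cdot> \<delta>"
  shows "finite_as_set_over f nonneg nonneg"
proof -
  have \<gamma>: "0 < \<gamma>" "\<And>a. 0 < a \<Longrightarrow> \<gamma> \<le> a"
    using assms(1) by (auto simp: smallest_positive_def nonneg_def)
  have "0 < \<delta>"
  proof (rule ccontr)
    assume "\<not> 0 < \<delta>"
    then have "0 \<le> int n \<cdot> (- \<delta>)" by (intro int_multiple_nonneg) auto
    then have "f \<gamma> \<le> 0" by (simp add: assms(3))
    then show False using \<gamma>(1) map_pos_iff[of \<gamma>] by simp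
  qed
  define T where "T = (\<lambda>r. r \<cdot> \<delta>) ` {0..<int n}"
  have T: "T \<subseteq> nonneg"
    using \<open>0 < \<delta>\<close> by (auto simp: T_def nonneg_def intro!: int_multiple_nonneg)
  have "nonneg = f ` nonneg + T"
  proof
    show "f ` nonneg + T \<subseteq> nonneg"
      using T by (auto simp: nonneg_def map_nonneg_iff elim!: set_plus_elim intro!: add_nonneg_nonneg)
    show "nonneg \<subseteq> f ` nonneg + T"
    proof
      fix x :: 's assume "x \<in> nonneg"
      obtain b k where x: "x = f b + k \<cdot> \<delta>" using gen by blast
      define r where "r = k mod int n"
      define a where "a = b + (k div int n) \<cdot> \<gamma>"
      have "k = (k div int n) * int n + r" by (simp add: r_def)
      then have "k \<cdot> \<delta> = (k div int n) \<cdot> int n \<cdot> \<delta> + r \<cdot> \<delta>"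
        by (metis int_multiple_add_left int_module.scale_scale)
      then have xa: "x = f a + r \<cdot> \<delta>"
        by (simp add: x a_def map_add map_int_multiple assms(3) add.assoc)
      have r: "0 \<le> r" "r < int n" using assms(2) by (auto simp: r_def)
      have "0 \<le> a"
      proof (rule ccontr)
        assume "\<not> 0 \<le> a"
        then have "f \<gamma> \<le> f (- a)" unfolding map_le_iff by (intro \<gamma>(2)) simp
        then have "f a + f \<gamma> \<le> 0" using add_left_mono[of "f \<gamma>" "- f a" "f a"] by (simp add: map_minus)
        moreover have "f a + f \<gamma> = x + (int n - r) \<cdot> \<delta>"
          by (simp add: xa int_multiple_diff_left assms(3))
        moreover have "0 < (int n - r) \<cdot> \<delta>" using r \<open>0 < \<delta>\<close> by (intro int_multiple_pos) auto
        ultimately have "x < 0" using add_nonneg_pos[of x "(int n - r) \<cdot> \<delta>"] by (metis leD not_le)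
        then show False using \<open>x \<in> nonneg\<close> by (simp add: nonneg_def)
      qed
      then show "x \<in> f ` nonneg + T"
        unfolding xa using r by (intro set_plus_intro) (auto simp: nonneg_def T_def)
    qed
  qed
  then show ?thesis
    unfolding finite_as_set_over_def using T by (intro exI[of _ T]) (auto simp: T_def)
qed

text \<open>
  Every nonnegative element of the coset of \<open>x\<close> lies above an element of \<open>S\<close> in the same coset, and
  there are finitely many of those. The coset has nonnegative elements because, for negative \<open>x\<close>
  and \<open>m x\<close> in the range of \<open>f\<close>, the element \<open>x - m x\<close> is one.
\<close>

lemma least_nonneg_in_coset:
  assumes "finite S" "nonneg = f ` nonneg + S"
  obtains a where "0 \<le> x + f a" "\<And>b. 0 \<le> x + f b \<Longrightarrow> x + f a \<le> x + f b"
proof -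
  define C where "C = S \<inter> range (\<lambda>a. x + f a)"
  have below: "\<exists>c\<in>C. c \<le> x + f b" if "0 \<le> x + f b" for b
  proof -
    have "x + f b \<in> f ` nonneg + S" unfolding assms(2)[symmetric] using that by (simp add: nonneg_def)
    then obtain p s where ps: "0 \<le> p" "s \<in> S" "x + f b = f p + s"
      by (auto simp: nonneg_def elim!: set_plus_elim)
    then have "s = x + f (b - p)" by (simp add: map_diff algebra_simps)
    moreover have "s \<le> x + f b" using ps map_nonneg_iff[of p] by simp
    ultimately show ?thesis using ps(2) unfolding C_def by blast
  qed
  have "\<exists>b. 0 \<le> x + f b"
  proof (cases "0 \<le> x")
    case True
    then show ?thesis by (intro exI[of _ 0]) (simp add: map_zero)
  next
    case False
    obtain m g where m: "0 < m" "int m \<cdot> x = f g" using multiple_in_range by blast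
    have "0 \<le> (int m - 1) \<cdot> (- x)" using m(1) False by (intro int_multiple_nonneg) auto
    then have "0 \<le> x + f (- g)"
      by (simp add: int_multiple_diff_left m(2) map_minus algebra_simps)
    then show ?thesis by blast
  qed
  then have C: "finite C" "C \<noteq> {}" using below assms(1) by (auto simp: C_def)
  then have "Min C \<in> C" by simp
  then obtain a where a: "Min C = x + f a" by (auto simp: C_def)
  have "S \<subseteq> nonneg"
  proof
    fix s assume "s \<in> S"
    then have "f 0 + s \<in> f ` nonneg + S" by (intro set_plus_intro) (auto simp: nonneg_def)
    then show "s \<in> nonneg" unfolding assms(2)[symmetric] by (simp add: map_zero)
  qed
  moreover have "x + f a \<in> S" using \<open>Min C \<in> C\<close> unfolding a by (simp add: C_def)
  ultimately have "0 \<le> x + f a" by (auto simp: nonneg_def)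
  moreover have "x + f a \<le> x + f b" if "0 \<le> x + f b" for b
    using below[OF that] Min_le[OF C(1)] a by (metis order_trans)
  ultimately show ?thesis by (rule that)
qed

text \<open>
  The smallest positive element is the sum of the least nonnegative elements of two opposite
  cosets different from the range of \<open>f\<close>.
\<close>

lemma finite_imp_smallest_positive:
  assumes "finite S" "nonneg = f ` nonneg + S" and "range f \<noteq> UNIV"
  shows "\<exists>\<gamma>::'g. smallest_positive \<gamma>"
proof -
  obtain x where x: "x \<notin> range f" using assms(3) by auto
  obtain a where a: "0 \<le> x + f a" "\<And>b. 0 \<le> x + f b \<Longrightarrow> x + f a \<le> x + f b"
    using least_nonneg_in_coset[OF assms(1,2)] by blast
  obtain a' where a': "0 \<le> - x + f a'" "\<And>b. 0 \<le> - x + f b \<Longrightarrow> - x + f a' \<le> - x + f b"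
    using least_nonneg_in_coset[OF assms(1,2)] by blast
  have "x + f a \<noteq> 0"
    using x by (metis add_eq_0_iff2 map_minus rangeI)
  then have pos: "0 < a + a'"
    using add_pos_nonneg[of "x + f a" "- x + f a'"] a(1) a'(1) map_pos_iff[of "a + a'"]
    by (simp add: map_add order.strict_iff_order)
  moreover have "a + a' \<le> g" if "0 < g" for g
  proof -
    have "\<not> 0 \<le> x + f (a - g)"
    proof
      assume "0 \<le> x + f (a - g)"
      then have "f a \<le> f (a - g)" using a(2) by simp
      with that show False by (simp add: map_le_iff)
    qed
    then have "0 \<le> - x + f (g - a)" by (simp add: map_diff algebra_simps)
    then have "f a' \<le> f (g - a)" using a'(2) by simp
    then show ?thesis by (simp add: map_le_iff algebra_simps)
  qed
  ultimately have "smallest_positive (a + a')"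
    by (auto simp: smallest_positive_def nonneg_def order_less_le)
  then show ?thesis by blast
qed

text \<open>
  Some multiple of \<open>\<delta>\<close> is a positive element of the range of \<open>f\<close>, hence at least \<open>f \<gamma>\<close>. So the
  multiples of \<open>\<delta>\<close> eventually exceed \<open>x\<close> although the group need not be archimedean, and \<open>x\<close>
  differs from the last multiple below it by less than the smallest positive element.
\<close>

lemma multiple_of_smallest_positive:
  assumes \<delta>: "0 < \<delta>" "\<And>y. 0 < y \<Longrightarrow> \<delta> \<le> y"
    and \<gamma>: "smallest_positive \<gamma>" and x: "0 \<le> x" "x \<le> f \<gamma>"
  shows "\<exists>k. x = int k \<cdot> \<delta>"
proof -
  obtain m g where m: "0 < m" "int m \<cdot> \<delta> = f g" using multiple_in_range by blast
  have "0 < int m \<cdot> \<delta>" using m(1) \<delta>(1) by (intro int_multiple_pos) auto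
  then have "0 < g" by (simp add: m(2) map_pos_iff)
  then have "f \<gamma> \<le> int m \<cdot> \<delta>"
    using \<gamma> by (auto simp: m(2) map_le_iff smallest_positive_def nonneg_def)
  then have "x < int (Suc m) \<cdot> \<delta>"
    using add_less_le_mono[OF \<delta>(1), of x "int m \<cdot> \<delta>"] x(2) by (simp add: int_multiple_add_left)
  then have "\<exists>j. x < int j \<cdot> \<delta>" by blast
  define k where "k = (LEAST j. x < int j \<cdot> \<delta>)"
  have k: "x < int k \<cdot> \<delta>" unfolding k_def using \<open>\<exists>j. x < int j \<cdot> \<delta>\<close> by (rule LeastI_ex)
  then have "k \<noteq> 0" using x(1) by (intro notI) simp
  then obtain l where l: "k = Suc l" by (cases k) auto
  then have "\<not> x < int l \<cdot> \<delta>" using not_less_Least[of l "\<lambda>j. x < int j \<cdot> \<delta>"] by (simp add: k_def)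
  moreover have "\<not> 0 < x - int l \<cdot> \<delta>"
    using \<delta>(2)[of "x - int l \<cdot> \<delta>"] k by (auto simp: l int_multiple_add_left algebra_simps)
  ultimately show ?thesis by auto
qed

text \<open>
  Everything positive lies above \<open>f \<gamma>\<close> or above a positive element of \<open>S\<close>, so the least of these
  finitely many elements is the smallest positive element \<open>\<delta>\<close> of the target. The least
  nonnegative element of a coset is at most \<open>f \<gamma>\<close>, hence a multiple of \<open>\<delta>\<close>.
\<close>

lemma finite_imp_adjoined_fraction:
  assumes "finite_as_set_over f nonneg nonneg" "range f \<noteq> UNIV"
  shows "\<exists>n\<ge>1. \<exists>\<gamma> \<delta>. smallest_positive \<gamma> \<and> int n \<cdot> \<delta> = f \<gamma> \<and>
    (\<forall>x. \<exists>a\<in>range f. \<exists>k. x = a + k \<cdot> \<delta>)"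
proof -
  obtain S where S: "finite S" "S \<subseteq> nonneg" "nonneg = f ` nonneg + S"
    using assms(1) unfolding finite_as_set_over_def by blast
  obtain \<gamma> :: 'g where sp: "smallest_positive \<gamma>"
    using finite_imp_smallest_positive[OF S(1,3) assms(2)] by blast
  have \<gamma>: "0 < \<gamma>" "\<And>a. 0 < a \<Longrightarrow> \<gamma> \<le> a"
    using sp by (auto simp: smallest_positive_def nonneg_def)
  define \<delta> where "\<delta> = Min (insert (f \<gamma>) (S - {0}))"
  have "\<delta> \<in> insert (f \<gamma>) (S - {0})" unfolding \<delta>_def using S(1) by (intro Min_in) auto
  then have "0 < \<delta>" using S(2) \<gamma>(1) map_pos_iff by (auto simp: nonneg_def order.strict_iff_order)
  have least: "\<delta> \<le> y" if "0 < y" for y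
  proof -
    have "y \<in> f ` nonneg + S" unfolding S(3)[symmetric] using that by (simp add: nonneg_def)
    then obtain p s where ps: "0 \<le> p" "s \<in> S" "y = f p + s"
      by (auto simp: nonneg_def elim!: set_plus_elim)
    have "\<exists>z\<in>insert (f \<gamma>) (S - {0}). z \<le> y"
    proof (cases "s = 0")
      case True
      then have "f \<gamma> \<le> y" using \<gamma>(2) that ps by (simp add: map_pos_iff map_le_iff)
      then show ?thesis by blast
    next
      case False
      then show ?thesis using ps map_nonneg_iff[of p] by (intro bexI[of _ s]) auto
    qed
    then show ?thesis unfolding \<delta>_def using S(1) by (meson Min_le finite_Diff finite_insert order_trans)
  qed
  have mult: "\<exists>k. x = int k \<cdot> \<delta>" if "0 \<le> x" "x \<le> f \<gamma>" for x
    using multiple_of_smallest_positive[OF \<open>0 < \<delta>\<close> least sp that] .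
  obtain n where n: "f \<gamma> = int n \<cdot> \<delta>" using mult[of "f \<gamma>"] \<gamma>(1) map_nonneg_iff[of \<gamma>] by fastforce
  have "n \<noteq> 0"
  proof
    assume "n = 0"
    then have "f \<gamma> = 0" using n by simp
    then show False using \<gamma>(1) map_pos_iff[of \<gamma>] by simp
  qed
  have "\<exists>a\<in>range f. \<exists>k. x = a + k \<cdot> \<delta>" for x
  proof -
    obtain a where a: "0 \<le> x + f a" "\<And>b. 0 \<le> x + f b \<Longrightarrow> x + f a \<le> x + f b"
      using least_nonneg_in_coset[OF S(1,3)] by blast
    have "x + f a \<le> f \<gamma>"
    proof (rule ccontr)
      assume "\<not> x + f a \<le> f \<gamma>"
      then have "0 \<le> x + f (a - \<gamma>)" by (simp add: map_diff algebra_simps)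
      then have "f a \<le> f (a - \<gamma>)" using a(2) by simp
      with \<gamma>(1) show False by (simp add: map_le_iff)
    qed
    then obtain k where "x + f a = int k \<cdot> \<delta>" using mult a(1) by blast
    then have "x = f (- a) + int k \<cdot> \<delta>" by (simp add: map_minus algebra_simps)
    then show ?thesis by blast
  qed
  with sp n \<open>n \<noteq> 0\<close> show ?thesis
    by (intro exI[of _ n] conjI exI[of _ \<gamma>] exI[of _ \<delta>]) auto
qed

end

theorem lemma2p5p4:
  fixes f :: "'g::linordered_ab_group_add \<Rightarrow> 's::linordered_ab_group_add"
  assumes "ordered_group_map f"
    and "inj f"
    and "finite (cokernel f)"
  shows "(finite_as_set_over f nonneg nonneg \<longleftrightarrow> finitely_generated_over f nonneg nonneg) \<and>
    (finitely_generated_over f nonneg nonneg \<longleftrightarrow>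
       range f = UNIV \<or>
       (discrete_group TYPE('g) \<and>
        (\<exists>n\<ge>1. \<exists>\<gamma>. smallest_positive \<gamma> \<and>
           rational_image (UNIV :: 's set) =
             rational_image (range f) + fractional_multiples n (f \<gamma>))))"
proof -
  interpret finite_index_extension f using assms by unfold_locales
  have ab: "finite_as_set_over f nonneg nonneg \<longleftrightarrow> finitely_generated_over f nonneg nonneg"
    using finite_imp_finitely_generated finitely_generated_imp_finite by blast
  have "0 \<in> range f" by (metis map_zero rangeI)
  then have fraction: "rational_image (UNIV :: 's set) =
      rational_image (range f) + fractional_multiples n (f \<gamma>) \<longleftrightarrow>
      (\<exists>\<delta>. int n \<cdot> \<delta> = f \<gamma> \<and> (\<forall>x. \<exists>a\<in>range f. \<exists>k. x = a + k \<cdot> \<delta>))" if "n \<ge> 1" for n \<gamma>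
    using that by (intro rational_image_eq_fractional_multiples_iff) auto
  have "finite_as_set_over f nonneg nonneg \<longleftrightarrow> range f = UNIV \<or>
       (discrete_group TYPE('g) \<and>
        (\<exists>n\<ge>1. \<exists>\<gamma>. smallest_positive \<gamma> \<and>
           rational_image (UNIV :: 's set) =
             rational_image (range f) + fractional_multiples n (f \<gamma>)))" (is "_ \<longleftrightarrow> _ \<or> ?D")
  proof
    assume fin: "finite_as_set_over f nonneg nonneg"
    show "range f = UNIV \<or> ?D"
    proof (cases "range f = UNIV")
      case False
      then obtain n \<gamma> \<delta> where "n \<ge> 1" "smallest_positive \<gamma>" "int n \<cdot> \<delta> = f \<gamma>"
        "\<forall>x. \<exists>a\<in>range f. \<exists>k. x = a + k \<cdot> \<delta>"
        using finite_imp_adjoined_fraction[OF fin] by blast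
      moreover from this have "discrete_group TYPE('g)"
        unfolding discrete_group_def by blast
      ultimately have ?D using fraction by blast
      then show ?thesis ..
    qed simp
  next
    assume "range f = UNIV \<or> ?D"
    then show "finite_as_set_over f nonneg nonneg"
    proof
      assume ?D
      then obtain n \<gamma> where n: "n \<ge> 1" "smallest_positive \<gamma>" and "rational_image (UNIV :: 's set) =
          rational_image (range f) + fractional_multiples n (f \<gamma>)" by blast
      then obtain \<delta> where "int n \<cdot> \<delta> = f \<gamma>" "\<And>x. \<exists>a\<in>range f. \<exists>k. x = a + k \<cdot> \<delta>"
        using fraction by blast
      with n show ?thesis by (intro adjoined_fraction_imp_finite[of \<gamma> n \<delta>]) auto
    qed (rule surj_imp_finite)
  qed
  with ab show ?thesis by blast
qed

end
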